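(* Let $\kappa$ be a supercompact cardinal and let $H$ be a dual group of cardinality $|H| \geq \kappa$. Then for every cardinal $\chi < \kappa$ there is a direct summand $H'$ of $H$ with $\chi \leq |H'| < \kappa$.
   Context: All groups are abelian. For an abelian group $G$, $G^* = \operatorname{Hom}(G, \mathbb{Z})$ denotes its dual group. An abelian group $H$ is called a dual group if $H \cong D^*$ for some abelian group $D$. Supercompact cardinals are understood in the usual set-theoretic sense. *)

theory Defs
  imports "HOL-Algebra.Elementary_Groups"
begin

unbundle cardinal_syntax

text \<open>
  A type \<open>'u\<close> serves as the universe of discourse: groups have carriers in \<open>'u\<close> and cardinals are
  cardinal orders (\<^const>\<open>Card_order\<close>) on subsets of \<open>'u\<close>. The type is arbitrary, so any given sets
  (for instance a group, a group of which it is the dual, and a cardinal) can be placed in one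
  such universe.
\<close>

section \<open>Supercompact cardinals\<close>

definition P_less :: "'k rel \<Rightarrow> 'u set \<Rightarrow> 'u set set" where
  "P_less \<kappa> A = {P. P \<subseteq> A \<and> |P| <o \<kappa>}"

definition ultrafilter_on :: "'a set \<Rightarrow> 'a set set \<Rightarrow> bool" where
  "ultrafilter_on S U \<longleftrightarrow>
     U \<subseteq> Pow S \<and> S \<in> U \<and> {} \<notin> U \<and>
     (\<forall>X\<in>U. \<forall>Y\<in>U. X \<inter> Y \<in> U) \<and>
     (\<forall>X\<in>U. \<forall>Y. X \<subseteq> Y \<and> Y \<subseteq> S \<longrightarrow> Y \<in> U) \<and>
     (\<forall>X. X \<subseteq> S \<longrightarrow> X \<in> U \<or> S - X \<in> U)"

definition complete_ultrafilter_on :: "'k rel \<Rightarrow> 'a set \<Rightarrow> 'a set set \<Rightarrow> bool" where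
  "complete_ultrafilter_on \<kappa> S U \<longleftrightarrow>
     ultrafilter_on S U \<and> (\<forall>F. F \<subseteq> U \<and> F \<noteq> {} \<and> |F| <o \<kappa> \<longrightarrow> \<Inter>F \<in> U)"

definition fine_on :: "'k rel \<Rightarrow> 'u set \<Rightarrow> 'u set set set \<Rightarrow> bool" where
  "fine_on \<kappa> A U \<longleftrightarrow> (\<forall>a\<in>A. {P \<in> P_less \<kappa> A. a \<in> P} \<in> U)"

definition diagonal_intersection ::
  "'k rel \<Rightarrow> 'u set \<Rightarrow> ('u \<Rightarrow> 'u set set) \<Rightarrow> 'u set set" where
  "diagonal_intersection \<kappa> A X = {P \<in> P_less \<kappa> A. \<forall>a\<in>P. P \<in> X a}"

text \<open>A normal measure on \<open>P\<^sub>\<kappa>(A)\<close>: a fine \<open>\<kappa>\<close>-complete ultrafilter closed under diagonal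
  intersections.\<close>

definition normal_measure_on :: "'k rel \<Rightarrow> 'u set \<Rightarrow> 'u set set set \<Rightarrow> bool" where
  "normal_measure_on \<kappa> A U \<longleftrightarrow>
     complete_ultrafilter_on \<kappa> (P_less \<kappa> A) U \<and>
     fine_on \<kappa> A U \<and>
     (\<forall>X. (\<forall>a\<in>A. X a \<in> U) \<longrightarrow> diagonal_intersection \<kappa> A X \<in> U)"

text \<open>
  An uncountable cardinal \<open>\<kappa>\<close> is supercompact if \<open>P\<^sub>\<kappa>(A)\<close> carries a normal measure for every set
  \<open>A\<close> with \<open>|A| \<ge> \<kappa>\<close>. (The definition by elementary embeddings of the set-theoretic universe
  quantifies over proper classes.) Here \<open>A\<close> ranges over all sets of the universe \<open>'u\<close>; this is
  implied by supercompactness in the sense of set theory, whatever the type \<open>'u\<close> is.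
\<close>

definition supercompact :: "'u rel \<Rightarrow> bool" where
  "supercompact \<kappa> \<longleftrightarrow>
     Card_order \<kappa> \<and> natLeq <o \<kappa> \<and>
     (\<forall>A :: 'u set. \<kappa> \<le>o |A| \<longrightarrow> (\<exists>U. normal_measure_on \<kappa> A U))"

section \<open>Dual groups and direct summands\<close>

text \<open>Homomorphisms are made extensional, so that each one is represented by exactly one
  HOL function.\<close>

definition dual :: "('a, 'b) monoid_scheme \<Rightarrow> ('a \<Rightarrow> int) monoid" where
  "dual G = \<lparr>carrier = hom G integer_group \<inter> extensional (carrier G),
             monoid.mult = (\<lambda>f g. \<lambda>x\<in>carrier G. f x + g x),
             one = (\<lambda>x\<in>carrier G. 0)\<rparr>"

definition dual_group :: "'u monoid \<Rightarrow> bool" where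
  "dual_group H \<longleftrightarrow> comm_group H \<and> (\<exists>D :: 'u monoid. comm_group D \<and> H \<cong> dual D)"

definition direct_summand :: "'a set \<Rightarrow> ('a, 'b) monoid_scheme \<Rightarrow> bool" where
  "direct_summand A G \<longleftrightarrow>
     subgroup A G \<and>
     (\<exists>B. subgroup B G \<and> A \<inter> B = {\<one>\<^bsub>G\<^esub>} \<and> A <#>\<^bsub>G\<^esub> B = carrier G)"

end

theory Submission
  imports Defs "HOL-Library.Countable"
begin

text \<open>
  Let \<open>H\<close> be the dual of \<open>D\<close> and let \<open>j\<close> be an elementary embedding given by a normal measure on
  \<open>P\<^sub>\<kappa>(A)\<close>, where \<open>A\<close> contains \<open>H\<close> and \<open>D\<close>. Restriction of homomorphisms along \<open>j\<close> sends \<open>j(H)\<close>,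
  the dual of \<open>j(D)\<close>, to \<open>H\<close>, and it is left inverse to \<open>j\<close> on \<open>H\<close>. So \<open>j[H]\<close> is a direct summand of
  \<open>j(H)\<close> whose size is below \<open>j(\<kappa>)\<close>, and elementarity reflects this to \<open>H\<close>. Without the embedding:
  as \<open>j[A]\<close> is represented by \<open>P \<mapsto> P\<close>, for almost all \<open>P\<close> the group \<open>H\<close> is the direct sum of
  \<open>P \<inter> H\<close> and the annihilator of \<open>P \<inter> D\<close>.
\<close>

section \<open>Pairings that identify \<open>H\<close> with the homomorphisms from \<open>D\<close>
  to the integers\<close>

locale dual_pairing = H: comm_group H + D: comm_group D
  for H :: "'a monoid" and D :: "'b monoid" +
  fixes e :: "'a \<Rightarrow> 'b \<Rightarrow> int"
  assumes e_mult: "\<lbrakk>h \<in> carrier H; h' \<in> carrier H; d \<in> carrier D\<rbrakk> \<Longrightarrow>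
      e (h \<otimes>\<^bsub>H\<^esub> h') d = e h d + e h' d"
    and e_hom: "\<lbrakk>h \<in> carrier H; d \<in> carrier D; d' \<in> carrier D\<rbrakk> \<Longrightarrow>
      e h (d \<otimes>\<^bsub>D\<^esub> d') = e h d + e h d'"
    and e_inj: "\<lbrakk>h \<in> carrier H; \<forall>d\<in>carrier D. e h d = 0\<rbrakk> \<Longrightarrow> h = \<one>\<^bsub>H\<^esub>"
    and e_surj: "\<forall>d\<in>carrier D. \<forall>d'\<in>carrier D. g (d \<otimes>\<^bsub>D\<^esub> d') = g d + g d' \<Longrightarrow>
      \<exists>h\<in>carrier H. \<forall>d\<in>carrier D. e h d = g d"
begin

lemma e_one: "d \<in> carrier D \<Longrightarrow> e \<one>\<^bsub>H\<^esub> d = 0"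
  using e_mult[of "\<one>\<^bsub>H\<^esub>" "\<one>\<^bsub>H\<^esub>" d] by simp

lemma e_inv: "\<lbrakk>h \<in> carrier H; d \<in> carrier D\<rbrakk> \<Longrightarrow> e (inv\<^bsub>H\<^esub> h) d = - e h d"
  using e_mult[of "inv\<^bsub>H\<^esub> h" h d] e_one by simp

end

section \<open>The quantifier "for almost all \<open>P\<close>" of a normal measure\<close>

locale normal_measure =
  fixes \<kappa> :: "'k rel" and A :: "'u set" and U :: "'u set set set"
  assumes normal_measure: "normal_measure_on \<kappa> A U"
begin

abbreviation ae :: "('u set \<Rightarrow> bool) \<Rightarrow> bool" where
  "ae Q \<equiv> {P \<in> P_less \<kappa> A. Q P} \<in> U"

lemma ultrafilter: "ultrafilter_on (P_less \<kappa> A) U"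
  using normal_measure by (simp add: normal_measure_on_def complete_ultrafilter_on_def)

lemma ae_mono:
  assumes "ae Q" and "\<And>P. P \<in> P_less \<kappa> A \<Longrightarrow> Q P \<Longrightarrow> R P"
  shows "ae R"
proof -
  have "{P \<in> P_less \<kappa> A. Q P} \<subseteq> {P \<in> P_less \<kappa> A. R P}"
    using assms(2) by auto
  then show ?thesis
    using assms(1) ultrafilter unfolding ultrafilter_on_def by blast
qed

lemma ae_conj:
  assumes "ae Q" and "ae R"
  shows "ae (\<lambda>P. Q P \<and> R P)"
proof -
  have "{P \<in> P_less \<kappa> A. Q P} \<inter> {P \<in> P_less \<kappa> A. R P} \<in> U"
    using assms ultrafilter unfolding ultrafilter_on_def by blast
  then show ?thesis
    by (rule back_subst[of "\<lambda>X. X \<in> U"]) auto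
qed

lemma ae_not:
  assumes "\<not> ae Q"
  shows "ae (\<lambda>P. \<not> Q P)"
proof -
  have "\<forall>X. X \<subseteq> P_less \<kappa> A \<longrightarrow> X \<in> U \<or> P_less \<kappa> A - X \<in> U"
    using ultrafilter by (simp add: ultrafilter_on_def)
  from this[rule_format, OF Collect_restrict] have "P_less \<kappa> A - {P \<in> P_less \<kappa> A. Q P} \<in> U"
    using assms by blast
  then show ?thesis
    by (rule back_subst[of "\<lambda>X. X \<in> U"]) auto
qed

lemma ae_ex:
  assumes "ae Q"
  shows "\<exists>P\<in>P_less \<kappa> A. Q P"
proof (rule ccontr)
  assume "\<not> ?thesis"
  then have "{P \<in> P_less \<kappa> A. Q P} = {}"
    by auto
  with assms have "{} \<in> U"
    by (simp only:)
  then show False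
    using ultrafilter by (simp add: ultrafilter_on_def)
qed

lemma ae_fine: "a \<in> A \<Longrightarrow> ae (\<lambda>P. a \<in> P)"
  using normal_measure by (simp add: normal_measure_on_def fine_on_def)

lemma ae_complete:
  assumes "|I| <o \<kappa>" and "\<And>i. i \<in> I \<Longrightarrow> ae (Q i)"
  shows "ae (\<lambda>P. \<forall>i\<in>I. Q i P)"
proof (cases "I = {}")
  \<comment> \<open>Completeness speaks of nonempty families only. For empty \<open>I\<close> the
    set in question is all of \<open>P_less \<kappa> A\<close>.\<close>
  case True
  then show ?thesis
    using ultrafilter by (simp add: ultrafilter_on_def)
next
  case False
  define F where "F = (\<lambda>i. {P \<in> P_less \<kappa> A. Q i P}) ` I"
  have "|F| <o \<kappa>"
    unfolding F_def using card_of_image assms(1) by (rule ordLeq_ordLess_trans)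
  moreover have "F \<subseteq> U" "F \<noteq> {}"
    using assms(2) False by (auto simp: F_def)
  ultimately have "\<Inter>F \<in> U"
    using normal_measure by (simp add: normal_measure_on_def complete_ultrafilter_on_def)
  then show ?thesis
    by (rule back_subst[of "\<lambda>X. X \<in> U"]) (use False in \<open>auto simp: F_def\<close>)
qed

lemma ae_diagonal:
  assumes "\<And>a. a \<in> A \<Longrightarrow> ae (Q a)"
  shows "ae (\<lambda>P. \<forall>a\<in>P. Q a P)"
proof -
  have "diagonal_intersection \<kappa> A (\<lambda>a. {P \<in> P_less \<kappa> A. Q a P}) \<in> U"
    using assms normal_measure by (simp add: normal_measure_on_def)
  then show ?thesis
    by (rule back_subst[of "\<lambda>X. X \<in> U"]) (auto simp: diagonal_intersection_def)
qed

text \<open>Normality asks for a property at every point of \<open>A\<close>; at points outside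
  \<open>B\<close> it is made vacuous by an implication. \<open>B\<close> will be a carrier or part
  of one.\<close>

lemma ae_diagonal_Int:
  assumes "\<And>a. a \<in> B \<Longrightarrow> ae (Q a)"
  shows "ae (\<lambda>P. \<forall>a\<in>P \<inter> B. Q a P)"
proof -
  have "ae (\<lambda>P. a \<in> B \<longrightarrow> Q a P)" for a
    using assms ultrafilter by (cases "a \<in> B") (auto simp: ultrafilter_on_def)
  then have "ae (\<lambda>P. \<forall>a\<in>P. a \<in> B \<longrightarrow> Q a P)"
    by (rule ae_diagonal)
  then show ?thesis
    by (rule ae_mono) auto
qed

text \<open>For a fixed \<open>a\<close>, fineness puts \<open>f a\<close> into almost all
  \<open>P\<close>; normality makes this uniform over the \<open>a\<close> in \<open>P\<close>.
  Applied to group operations and to choice functions for witnesses, this does the work of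
  elementarity.\<close>

lemma ae_closed:
  assumes "\<And>a. a \<in> B \<Longrightarrow> f a \<in> A"
  shows "ae (\<lambda>P. \<forall>a\<in>P \<inter> B. f a \<in> P)"
  by (intro ae_diagonal_Int ae_fine assms)

text \<open>If each value were avoided almost everywhere, completeness would avoid all of the
  countably many values at once, on a set of the ultrafilter and hence for some
  \<open>P\<close>.\<close>

lemma ae_constant:
  fixes f :: "'u set \<Rightarrow> 'c::countable"
  assumes "natLeq <o \<kappa>"
  shows "\<exists>c. ae (\<lambda>P. f P = c)"
proof (rule ccontr)
  assume "\<not> ?thesis"
  then have "ae (\<lambda>P. f P \<noteq> c)" for c
    using ae_not[of "\<lambda>P. f P = c"] by blast
  moreover have "|UNIV :: 'c set| <o \<kappa>"
  proof -
    have "|UNIV :: 'c set| \<le>o |UNIV :: nat set|"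
      by (rule card_of_ordLeqI[of to_nat]) auto
    then show ?thesis
      using assms card_of_nat by (metis ordIso_ordLess_trans ordLeq_ordLess_trans)
  qed
  ultimately have "ae (\<lambda>P. \<forall>c\<in>UNIV. f P \<noteq> c)"
    by (intro ae_complete)
  from ae_ex[OF this] show False
    by blast
qed

text \<open>The limit of the \<open>f P\<close> along the ultrafilter represents the restriction of \<open>[f]\<close> along \<open>j\<close>.\<close>

lemma ae_agree:
  fixes f :: "'u set \<Rightarrow> 'u \<Rightarrow> 'c::countable"
  assumes "natLeq <o \<kappa>"
  obtains g where "\<And>d. ae (\<lambda>P. f P d = g d)" and "ae (\<lambda>P. \<forall>d\<in>P. f P d = g d)"
proof -
  have "\<forall>d. \<exists>c. ae (\<lambda>P. f P d = c)"
    by (intro allI ae_constant[OF assms])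
  then obtain g where g: "\<And>d. ae (\<lambda>P. f P d = g d)"
    by metis
  show ?thesis
    by (rule that[of g, OF g ae_diagonal[OF g]])
qed

section \<open>The splitting of \<open>H\<close> at almost all \<open>P\<close>\<close>

lemma ae_direct_summand:
  fixes H :: "'u monoid" and D :: "'u monoid" and e :: "'u \<Rightarrow> 'u \<Rightarrow> int"
  assumes unc: "natLeq <o \<kappa>" and pairing: "dual_pairing H D e"
    and HA: "carrier H \<subseteq> A" and DA: "carrier D \<subseteq> A"
  shows "ae (\<lambda>P. direct_summand (P \<inter> carrier H) H)"
proof -
  interpret dual_pairing H D e by fact

  \<comment> \<open>The kernel of restricting homomorphisms to \<open>P \<inter> carrier D\<close>;
    it represents the kernel of restriction along \<open>j\<close>.\<close>
  define ann where "ann P = {h \<in> carrier H. \<forall>d\<in>P \<inter> carrier D. e h d = 0}" for P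
  have ann: "subgroup (ann P) H" for P
    by (rule H.subgroupI) (auto simp: ann_def e_one e_inv e_mult intro: H.one_closed)

  have ae_sub: "ae (\<lambda>P. subgroup (P \<inter> carrier H) H)"
  proof -
    \<comment> \<open>A binary operation takes two diagonal intersections: one over
      \<open>h'\<close> with \<open>h\<close> fixed, then one over \<open>h\<close>.\<close>
    have "ae (\<lambda>P. \<forall>h\<in>P \<inter> carrier H. \<forall>h'\<in>P \<inter> carrier H. h \<otimes>\<^bsub>H\<^esub> h' \<in> P)"
      using HA by (intro ae_diagonal_Int[of "carrier H"] ae_closed) auto
    moreover have "ae (\<lambda>P. \<forall>h\<in>P \<inter> carrier H. inv\<^bsub>H\<^esub> h \<in> P)"
      using HA by (intro ae_closed) auto
    moreover have "ae (\<lambda>P. \<one>\<^bsub>H\<^esub> \<in> P)"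
      using HA by (intro ae_fine) auto
    ultimately have "ae (\<lambda>P. (\<forall>h\<in>P \<inter> carrier H. \<forall>h'\<in>P \<inter> carrier H. h \<otimes>\<^bsub>H\<^esub> h' \<in> P) \<and>
        (\<forall>h\<in>P \<inter> carrier H. inv\<^bsub>H\<^esub> h \<in> P) \<and> \<one>\<^bsub>H\<^esub> \<in> P)"
      by (intro ae_conj)
    then show ?thesis
      by (rule ae_mono) (auto intro!: H.subgroupI)
  qed

  have ae_Int: "ae (\<lambda>P. P \<inter> carrier H \<inter> ann P \<subseteq> {\<one>\<^bsub>H\<^esub>})"
  proof -
    \<comment> \<open>Choose for each nontrivial \<open>h\<close> a point \<open>d h\<close> where
      it does not vanish. If \<open>P\<close> is closed under this choice, no nontrivial
      \<open>h\<close> in \<open>P\<close> annihilates \<open>P \<inter> carrier D\<close>.\<close>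
    have "\<exists>d. h \<in> carrier H - {\<one>\<^bsub>H\<^esub>} \<longrightarrow> d \<in> carrier D \<and> e h d \<noteq> 0" for h
      using e_inj[of h] by auto
    then obtain d where d: "\<And>h. h \<in> carrier H - {\<one>\<^bsub>H\<^esub>} \<Longrightarrow> d h \<in> carrier D \<and> e h (d h) \<noteq> 0"
      by metis
    have "ae (\<lambda>P. \<forall>h\<in>P \<inter> (carrier H - {\<one>\<^bsub>H\<^esub>}). d h \<in> P)"
      using d DA by (intro ae_closed) auto
    then show ?thesis
      by (rule ae_mono) (use d in \<open>fastforce simp: ann_def\<close>)
  qed

  \<comment> \<open>Agreement with some \<open>h\<close> in \<open>P\<close> on
    \<open>P \<inter> carrier D\<close> means that \<open>f\<close> lies in the product of
    \<open>P \<inter> carrier H\<close> and \<open>ann P\<close>.\<close>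
  define agree where "agree P f \<longleftrightarrow> (\<exists>h\<in>P \<inter> carrier H. \<forall>d\<in>P \<inter> carrier D. e f d = e h d)" for P f
  have ae_agree_H: "ae (\<lambda>P. \<forall>f\<in>carrier H. agree P f)" (is "ae ?Q")
  proof (rule ccontr)
    assume "\<not> ae ?Q"
    then have "ae (\<lambda>P. \<not> ?Q P)"
      by (rule ae_not)
    \<comment> \<open>One counterexample is chosen for each bad \<open>P\<close>, with the unit
      available at the others, so that \<open>f\<close> represents an element of
      \<open>j(H)\<close>.\<close>
    have "\<exists>f\<in>carrier H. \<not> ?Q P \<longrightarrow> \<not> agree P f" for P
      using H.one_closed by blast
    then obtain f where fH: "\<And>P. f P \<in> carrier H" and f: "\<And>P. \<not> ?Q P \<Longrightarrow> \<not> agree P (f P)"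
      by metis
    obtain g where g: "\<And>d. ae (\<lambda>P. e (f P) d = g d)"
      and ae_g: "ae (\<lambda>P. \<forall>d\<in>P. e (f P) d = g d)"
      using ae_agree[OF unc, of "\<lambda>P. e (f P)"] by blast
    \<comment> \<open>Additivity at \<open>d\<close> and \<open>d'\<close> involves only three
      values of \<open>g\<close>, and a single \<open>P\<close> realizes all three through the
      homomorphism \<open>e (f P)\<close>.\<close>
    have "g (d \<otimes>\<^bsub>D\<^esub> d') = g d + g d'" if "d \<in> carrier D" "d' \<in> carrier D" for d d'
    proof -
      have "\<exists>P\<in>P_less \<kappa> A. e (f P) d = g d \<and> e (f P) d' = g d' \<and>
          e (f P) (d \<otimes>\<^bsub>D\<^esub> d') = g (d \<otimes>\<^bsub>D\<^esub> d')"
        by (intro ae_ex ae_conj g)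
      then show ?thesis
        using e_hom[OF fH that] by metis
    qed
    then obtain h where h: "h \<in> carrier H" "\<forall>d\<in>carrier D. e h d = g d"
      using e_surj[of g] by blast
    \<comment> \<open>Since \<open>h\<close> does not depend on \<open>P\<close>, it lies in almost
      all \<open>P\<close>, and there it is the witness that \<open>f P\<close> was chosen to
      lack.\<close>
    have "ae (\<lambda>P. h \<in> P)"
      using h HA by (intro ae_fine) auto
    with \<open>ae (\<lambda>P. \<not> ?Q P)\<close> ae_g
    have "ae (\<lambda>P. \<not> ?Q P \<and> (\<forall>d\<in>P. e (f P) d = g d) \<and> h \<in> P)"
      by (intro ae_conj)
    from ae_ex[OF this] obtain P where P: "\<not> ?Q P" "\<forall>d\<in>P. e (f P) d = g d" "h \<in> P"
      by blast
    then have "agree P (f P)"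
      unfolding agree_def using h by (intro bexI[of _ h]) auto
    with f[OF P(1)] show False
      by contradiction
  qed

  have "ae (\<lambda>P. subgroup (P \<inter> carrier H) H \<and> P \<inter> carrier H \<inter> ann P \<subseteq> {\<one>\<^bsub>H\<^esub>} \<and> ?Q P)"
    by (intro ae_conj ae_sub ae_Int ae_agree_H)
  then show ?thesis
  proof (rule ae_mono)
    fix P assume "P \<in> P_less \<kappa> A"
      and P: "subgroup (P \<inter> carrier H) H \<and> P \<inter> carrier H \<inter> ann P \<subseteq> {\<one>\<^bsub>H\<^esub>} \<and> ?Q P"
    have "f \<in> (P \<inter> carrier H) <#>\<^bsub>H\<^esub> ann P" if f: "f \<in> carrier H" for f
    proof -
      obtain h where h: "h \<in> P \<inter> carrier H" "\<forall>d\<in>P \<inter> carrier D. e f d = e h d"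
        using P f unfolding agree_def by blast
      then have "inv\<^bsub>H\<^esub> h \<otimes>\<^bsub>H\<^esub> f \<in> ann P"
        using f by (auto simp: ann_def e_mult e_inv)
      moreover have "f = h \<otimes>\<^bsub>H\<^esub> (inv\<^bsub>H\<^esub> h \<otimes>\<^bsub>H\<^esub> f)"
        using h f by (simp add: H.m_assoc[symmetric])
      ultimately show ?thesis
        using h by (auto simp: set_mult_def)
    qed
    moreover have "(P \<inter> carrier H) <#>\<^bsub>H\<^esub> ann P \<subseteq> carrier H"
      by (auto simp: set_mult_def ann_def)
    moreover have "P \<inter> carrier H \<inter> ann P = {\<one>\<^bsub>H\<^esub>}"
      using P subgroup.one_closed[OF ann] subgroup.one_closed by blast
    ultimately show "direct_summand (P \<inter> carrier H) H"
      using P ann unfolding direct_summand_def by blast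
  qed
qed

end

section \<open>The pairing of a dual group, read off from its isomorphism\<close>

lemma dual_group_pairing:
  fixes H :: "'u monoid"
  assumes "dual_group H"
  obtains D :: "'u monoid" and e :: "'u \<Rightarrow> 'u \<Rightarrow> int" where "dual_pairing H D e"
proof -
  obtain D :: "'u monoid" and e where D: "comm_group D" and e: "e \<in> iso H (dual D)"
    using assms by (auto simp: dual_group_def is_iso_def)
  interpret H: comm_group H using assms by (simp add: dual_group_def)
  interpret D: comm_group D by fact
  have e_mem: "e h \<in> hom D integer_group" "e h \<in> extensional (carrier D)" if "h \<in> carrier H" for h
    using e that by (auto simp: iso_def hom_def dual_def)
  have e_mult: "e (h \<otimes>\<^bsub>H\<^esub> h') d = e h d + e h' d"
    if "h \<in> carrier H" "h' \<in> carrier H" "d \<in> carrier D" for h h' d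
    using e that by (auto simp: iso_def hom_def dual_def)
  have inj: "inj_on e (carrier H)" and surj: "e ` carrier H = carrier (dual D)"
    using e by (auto simp: iso_def bij_betw_def)
  have "dual_pairing H D e"
  proof (unfold_locales, fact e_mult)
    show "e h (d \<otimes>\<^bsub>D\<^esub> d') = e h d + e h d'"
      if "h \<in> carrier H" "d \<in> carrier D" "d' \<in> carrier D" for h d d'
      using hom_mult[OF e_mem(1)[OF that(1)] that(2,3)] by simp
    show "h = \<one>\<^bsub>H\<^esub>" if h: "h \<in> carrier H" "\<forall>d\<in>carrier D. e h d = 0" for h
    proof -
      have "e h d = e \<one>\<^bsub>H\<^esub> d" if "d \<in> carrier D" for d
        using e_mult[of "\<one>\<^bsub>H\<^esub>" "\<one>\<^bsub>H\<^esub>" d] that h by simp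
      \<comment> \<open>Agreement on \<open>carrier D\<close> suffices, because both functions are
        extensional.\<close>
      then have "e h = e \<one>\<^bsub>H\<^esub>"
        using e_mem(2) h by (intro extensionalityI[of _ "carrier D"]) auto
      then show ?thesis
        using inj h by (auto dest: inj_onD)
    qed
    show "\<exists>h\<in>carrier H. \<forall>d\<in>carrier D. e h d = g d"
      if "\<forall>d\<in>carrier D. \<forall>d'\<in>carrier D. g (d \<otimes>\<^bsub>D\<^esub> d') = g d + g d'" for g
    proof -
      have "restrict g (carrier D) \<in> carrier (dual D)"
        using that by (auto simp: dual_def hom_def)
      then obtain h where "h \<in> carrier H" "e h = restrict g (carrier D)"
        using surj by (metis imageE)
      then show ?thesis
        by (intro bexI[of _ h]) auto
    qed
  qed
  then show ?thesis
    by (rule that)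
qed

section \<open>Choice of a single \<open>P\<close> of suitable size\<close>

theorem theorem1p1:
  fixes \<kappa> :: "'u rel" and H :: "'u monoid"
  assumes "supercompact \<kappa>"
    and "dual_group H"
    and "\<kappa> \<le>o |carrier H|"
  shows "\<forall>\<chi> :: 'u rel. Card_order \<chi> \<and> \<chi> <o \<kappa> \<longrightarrow>
           (\<exists>H'. direct_summand H' H \<and> \<chi> \<le>o |H'| \<and> |H'| <o \<kappa>)"
proof (intro allI impI, elim conjE)
  fix \<chi> :: "'u rel"
  assume "Card_order \<chi>" and \<chi>: "\<chi> <o \<kappa>"
  \<comment> \<open>The measure is taken over the whole universe, which contains both
    \<open>H\<close> and \<open>D\<close>.\<close>
  have "\<kappa> \<le>o |UNIV :: 'u set|"
    using assms(3) card_of_mono1[OF subset_UNIV] by (rule ordLeq_transitive)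
  then obtain U where "normal_measure_on \<kappa> (UNIV :: 'u set) U" and unc: "natLeq <o \<kappa>"
    using assms(1) by (auto simp: supercompact_def)
  then interpret normal_measure \<kappa> UNIV U
    by (simp add: normal_measure_def)
  obtain D :: "'u monoid" and e where "dual_pairing H D e"
    by (rule dual_group_pairing[OF assms(2)])
  then have ae_summand: "ae (\<lambda>P. direct_summand (P \<inter> carrier H) H)"
    by (rule ae_direct_summand[OF unc _ subset_UNIV subset_UNIV])
  have Field_\<chi>: "|Field \<chi>| =o \<chi>"
    using \<open>Card_order \<chi>\<close> by (rule card_of_Field_ordIso)
  have "|Field \<chi>| \<le>o |carrier H|"
    using Field_\<chi> \<chi> assms(3)
    by (meson ordIso_ordLeq_trans ordLeq_transitive ordLess_imp_ordLeq)
  \<comment> \<open>A copy of \<chi> inside \<open>H\<close>. Its fewer than \<kappa> points lie in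
    almost all \<open>P\<close> simultaneously, which bounds the summand from below; the upper bound
    comes from \<open>P_less\<close>.\<close>
  then obtain S where S: "S \<subseteq> carrier H" "|Field \<chi>| =o |S|"
    using internalize_card_of_ordLeq2 by blast
  then have \<chi>S: "\<chi> =o |S|"
    using Field_\<chi> ordIso_symmetric ordIso_transitive by blast
  then have "|S| <o \<kappa>"
    using \<chi> ordIso_ordLess_trans ordIso_symmetric by blast
  then have "ae (\<lambda>P. \<forall>s\<in>S. s \<in> P)"
    by (intro ae_complete ae_fine UNIV_I)
  then obtain P where P: "P \<in> P_less \<kappa> UNIV" "direct_summand (P \<inter> carrier H) H" "\<forall>s\<in>S. s \<in> P"
    using ae_ex[OF ae_conj[OF ae_summand \<open>ae (\<lambda>P. \<forall>s\<in>S. s \<in> P)\<close>]] by blast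
  have "|P \<inter> carrier H| <o \<kappa>"
    using P(1) card_of_mono1[of "P \<inter> carrier H" P] ordLeq_ordLess_trans
    by (auto simp: P_less_def)
  moreover have "\<chi> \<le>o |P \<inter> carrier H|"
    using \<chi>S S(1) P(3) card_of_mono1[of S "P \<inter> carrier H"] by (auto intro: ordIso_ordLeq_trans)
  ultimately show "\<exists>H'. direct_summand H' H \<and> \<chi> \<le>o |H'| \<and> |H'| <o \<kappa>"
    using P(2) by blast
qed

end
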